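(* Let $(\underline\alpha,\overline\alpha)\subseteq\mathbb R$ be a finite or infinite interval, let $\mathfrak D\subset\mathbb C$ be a stability region such that $\alpha\lambda\in\mathfrak D$ for every $\lambda\in\mathfrak D$ and $\alpha\in(\underline\alpha,\overline\alpha)$, let $\mathcal G\subset\mathcal M^{n\times n}$ be an arbitrary matrix class, and let $\circ$ be a binary operation on $\mathcal M^{n\times n}$. Suppose one of the following holds: 1. $\alpha(\mathbf A\circ\mathbf B)=(\alpha\mathbf A)\circ\mathbf B=\mathbf A\circ(\alpha\mathbf B)$ for all $\alpha\in\mathbb R$ and $\mathbf A,\mathbf B\in\mathcal M^{n\times n}$; 2. $\alpha(\mathbf A\circ\mathbf B)=(\alpha\mathbf A)\circ(\alpha\mathbf B)$ for all $\alpha\in\mathbb R$ and $\mathbf A,\mathbf B\in\mathcal M^{n\times n}$, the interval $(\underline\alpha,\overline\alpha)$ does not contain $0$, and $\frac1\alpha\mathbf G\in\mathcal G$ for every $\mathbf G\in\mathcal G$ and every $\alpha\in(\underline\alpha,\overline\alpha)$. Then, if a matrix $\mathbf A\in\mathcal M^{n\times n}$ is $(\mathfrak D,\mathcal G,\circ)$-stable, the matrix $\alpha\mathbf A$ is $(\mathfrak D,\mathcal G,\circ)$-stable for every $\alpha\in(\underline\alpha,\overline\alpha)$.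
   Context: $\mathcal M^{n\times n}$ is the set of real $n\times n$ matrices and $\sigma(\mathbf A)$ is the set of (complex) eigenvalues of $\mathbf A$. A stability region is a set $\mathfrak D\subset\mathbb C$ closed under complex conjugation. A matrix $\mathbf A$ is left (right) $(\mathfrak D,\mathcal G,\circ)$-stable if $\sigma(\mathbf G\circ\mathbf A)\subset\mathfrak D$ (respectively $\sigma(\mathbf A\circ\mathbf G)\subset\mathfrak D$) for every $\mathbf G\in\mathcal G$; it is $(\mathfrak D,\mathcal G,\circ)$-stable if it is both. *)

theory Defs
  imports
    "HOL-Analysis.Interval_Integral"
    "Jordan_Normal_Form.Spectral_Radius"
begin

definition stability_region :: "complex set \<Rightarrow> bool" where
  "stability_region D \<longleftrightarrow> (\<forall>z\<in>D. cnj z \<in> D)"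

text \<open>The spectrum of a real matrix consists of its complex eigenvalues, so the entries
  are embedded into the complex numbers before applying \<^const>\<open>spectrum\<close>.\<close>

definition cspectrum :: "real mat \<Rightarrow> complex set" where
  "cspectrum A = spectrum (map_mat complex_of_real A)"

definition DG_left_stable ::
  "complex set \<Rightarrow> real mat set \<Rightarrow> (real mat \<Rightarrow> real mat \<Rightarrow> real mat) \<Rightarrow> real mat \<Rightarrow> bool" where
  "DG_left_stable D \<G> bop A \<longleftrightarrow> (\<forall>G\<in>\<G>. cspectrum (bop G A) \<subseteq> D)"

definition DG_right_stable ::
  "complex set \<Rightarrow> real mat set \<Rightarrow> (real mat \<Rightarrow> real mat \<Rightarrow> real mat) \<Rightarrow> real mat \<Rightarrow> bool" where
  "DG_right_stable D \<G> bop A \<longleftrightarrow> (\<forall>G\<in>\<G>. cspectrum (bop A G) \<subseteq> D)"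

definition DG_stable ::
  "complex set \<Rightarrow> real mat set \<Rightarrow> (real mat \<Rightarrow> real mat \<Rightarrow> real mat) \<Rightarrow> real mat \<Rightarrow> bool" where
  "DG_stable D \<G> bop A \<longleftrightarrow> DG_left_stable D \<G> bop A \<and> DG_right_stable D \<G> bop A"

end

theory Submission
  imports Defs
begin

text \<open>Under either alternative the scalar can be pulled out of the product: for each G in the
  class there is an H in the class such that \<open>bop G (\<alpha> \<cdot>\<^sub>m A)\<close> is
  \<alpha> times \<open>bop H A\<close>, and symmetrically on the other side. Stability of A puts
  the spectra of \<open>bop H A\<close> and \<open>bop A H\<close> inside D. By
  \<open>cspectrum_smult_subset\<close>, scaling a matrix by \<alpha> sends its spectrum into
  \<alpha> times the old one, and D absorbs multiplication by \<alpha>. The delicate case is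
  \<alpha> = 0, possible under the first alternative: the eigenvalue 0 of the zero matrix has to be
  written as 0 * z with z an eigenvalue of the original matrix.\<close>

lemma eigenvalue_smult_mat:
  fixes M :: "'a :: field mat"
  assumes M: "M \<in> carrier_mat n n" and "c \<noteq> 0" and k: "eigenvalue (c \<cdot>\<^sub>m M) k"
  shows "eigenvalue M (k / c)"
proof -
  obtain v where v: "v \<in> carrier_vec n" "v \<noteq> 0\<^sub>v n" and eq: "(c \<cdot>\<^sub>m M) *\<^sub>v v = k \<cdot>\<^sub>v v"
    using k M unfolding eigenvalue_def eigenvector_def by auto
  have "(c \<cdot>\<^sub>m M) *\<^sub>v v = c \<cdot>\<^sub>v (M *\<^sub>v v)"
    using M v by (intro eq_vecI) auto
  then have "(1 / c) \<cdot>\<^sub>v (c \<cdot>\<^sub>v (M *\<^sub>v v)) = (1 / c) \<cdot>\<^sub>v (k \<cdot>\<^sub>v v)"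
    using eq by simp
  then have "M *\<^sub>v v = (k / c) \<cdot>\<^sub>v v"
    using \<open>c \<noteq> 0\<close> by (simp add: smult_smult_assoc)
  then show ?thesis
    using v M unfolding eigenvalue_def eigenvector_def by auto
qed

text \<open>An eigenvector has a nonzero coordinate \<open>v $ i\<close>, and there the eigenvalue
  equation reads 0 = k * \<open>v $ i\<close>. The index i also witnesses n > 0, which is recorded
  because a matrix of size 0 has empty spectrum.\<close>

lemma eigenvalue_zero_mat:
  fixes k :: "'a :: field"
  assumes k: "eigenvalue (0\<^sub>m n n) k"
  shows "k = 0 \<and> n > 0"
proof -
  obtain v where v: "v \<in> carrier_vec n" "v \<noteq> 0\<^sub>v n" and eq: "0\<^sub>m n n *\<^sub>v v = k \<cdot>\<^sub>v v"
    using k unfolding eigenvalue_def eigenvector_def by auto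
  obtain i where i: "i < n" "v $ i \<noteq> 0"
    using v by (metis carrier_vecD eq_vecI index_zero_vec)
  have "(k \<cdot>\<^sub>v v) $ i = 0"
    using v i by (simp add: eq[symmetric])
  then show ?thesis
    using i v by auto
qed

text \<open>For nonzero \<alpha>, divide the eigenvalue by \<alpha>. Phrasing the result as an
  inclusion in the image covers \<alpha> = 0 as well, where knowing only that k = 0 would not
  suffice: D is not assumed to contain 0, but it does contain 0 * z once z lies in D.\<close>

lemma cspectrum_smult_subset:
  assumes M: "M \<in> carrier_mat n n"
  shows "cspectrum (\<alpha> \<cdot>\<^sub>m M) \<subseteq> (\<lambda>z. complex_of_real \<alpha> * z) ` cspectrum M"
proof
  fix k assume k: "k \<in> cspectrum (\<alpha> \<cdot>\<^sub>m M)"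
  define C where "C = map_mat complex_of_real M"
  have C: "C \<in> carrier_mat n n"
    using M by (simp add: C_def)
  have "map_mat complex_of_real (\<alpha> \<cdot>\<^sub>m M) = complex_of_real \<alpha> \<cdot>\<^sub>m C"
    by (auto simp: C_def)
  then have ev: "eigenvalue (complex_of_real \<alpha> \<cdot>\<^sub>m C) k"
    using k by (simp add: cspectrum_def spectrum_def)
  show "k \<in> (\<lambda>z. complex_of_real \<alpha> * z) ` cspectrum M"
  proof (cases "\<alpha> = 0")
    case True
    have "complex_of_real \<alpha> \<cdot>\<^sub>m C = 0\<^sub>m n n"
      using True C by auto
    then have "k = 0" "n > 0"
      using ev eigenvalue_zero_mat by auto
    \<comment> \<open>Scaling by \<open>0\<close> needs some eigenvalue of \<open>M\<close> to exist; this is where the base field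
      must be algebraically closed.\<close>
    then obtain z where "z \<in> spectrum C"
      using spectrum_non_empty[OF C] by auto
    then show ?thesis
      using True \<open>k = 0\<close> by (auto simp: cspectrum_def C_def)
  next
    case False
    then have "k / complex_of_real \<alpha> \<in> cspectrum M"
      using eigenvalue_smult_mat[OF C _ ev] by (simp add: cspectrum_def spectrum_def C_def)
    then show ?thesis
      using False by (intro image_eqI[of _ _ "k / complex_of_real \<alpha>"]) auto
  qed
qed

theorem theorem82:
  fixes n :: nat
    and lo hi :: ereal
    and D :: "complex set"
    and \<G> :: "real mat set"
    and bop :: "real mat \<Rightarrow> real mat \<Rightarrow> real mat"
  assumes "stability_region D"
    and "\<forall>z\<in>D. \<forall>\<alpha>\<in>einterval lo hi. complex_of_real \<alpha> * z \<in> D"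
    and "\<G> \<subseteq> carrier_mat n n"
    and "bop \<in> carrier_mat n n \<rightarrow> carrier_mat n n \<rightarrow> carrier_mat n n"
    and "(\<forall>\<alpha>. \<forall>A\<in>carrier_mat n n. \<forall>B\<in>carrier_mat n n.
            \<alpha> \<cdot>\<^sub>m bop A B = bop (\<alpha> \<cdot>\<^sub>m A) B \<and> bop (\<alpha> \<cdot>\<^sub>m A) B = bop A (\<alpha> \<cdot>\<^sub>m B))
       \<or> ((\<forall>\<alpha>. \<forall>A\<in>carrier_mat n n. \<forall>B\<in>carrier_mat n n.
            \<alpha> \<cdot>\<^sub>m bop A B = bop (\<alpha> \<cdot>\<^sub>m A) (\<alpha> \<cdot>\<^sub>m B))
          \<and> 0 \<notin> einterval lo hi
          \<and> (\<forall>G\<in>\<G>. \<forall>\<alpha>\<in>einterval lo hi. (1 / \<alpha>) \<cdot>\<^sub>m G \<in> \<G>))"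
  shows "\<forall>A\<in>carrier_mat n n. DG_stable D \<G> bop A \<longrightarrow>
           (\<forall>\<alpha>\<in>einterval lo hi. DG_stable D \<G> bop (\<alpha> \<cdot>\<^sub>m A))"
proof (intro ballI impI)
  fix A \<alpha>
  assume A: "A \<in> carrier_mat n n" and st: "DG_stable D \<G> bop A" and \<alpha>: "\<alpha> \<in> einterval lo hi"
  have bop: "bop X Y \<in> carrier_mat n n" if "X \<in> carrier_mat n n" "Y \<in> carrier_mat n n" for X Y
    using assms(4) that by auto
  have scale: "cspectrum (\<alpha> \<cdot>\<^sub>m M) \<subseteq> D" if "M \<in> carrier_mat n n" "cspectrum M \<subseteq> D" for M
    using cspectrum_smult_subset[OF that(1), of \<alpha>] that(2) assms(2) \<alpha> by blast
  \<comment> \<open>The two alternatives meet here: one H serves both the left and the right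
    product, and the rest of the argument no longer depends on which alternative holds.\<close>
  have factor: "\<exists>H\<in>\<G>. bop G (\<alpha> \<cdot>\<^sub>m A) = \<alpha> \<cdot>\<^sub>m bop H A \<and> bop (\<alpha> \<cdot>\<^sub>m A) G = \<alpha> \<cdot>\<^sub>m bop A H"
    if G: "G \<in> \<G>" for G
    using assms(5)
  proof (elim disjE conjE)
    assume "\<forall>\<alpha>. \<forall>A\<in>carrier_mat n n. \<forall>B\<in>carrier_mat n n.
            \<alpha> \<cdot>\<^sub>m bop A B = bop (\<alpha> \<cdot>\<^sub>m A) B \<and> bop (\<alpha> \<cdot>\<^sub>m A) B = bop A (\<alpha> \<cdot>\<^sub>m B)"
    \<comment> \<open>Here H = G, since the scalar may be moved out of either operand alone.\<close>
    then show ?thesis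
      using G A assms(3) by (metis subsetD)
  next
    assume hom: "\<forall>\<alpha>. \<forall>A\<in>carrier_mat n n. \<forall>B\<in>carrier_mat n n.
            \<alpha> \<cdot>\<^sub>m bop A B = bop (\<alpha> \<cdot>\<^sub>m A) (\<alpha> \<cdot>\<^sub>m B)"
      and "0 \<notin> einterval lo hi"
      and inv: "\<forall>G\<in>\<G>. \<forall>\<alpha>\<in>einterval lo hi. (1 / \<alpha>) \<cdot>\<^sub>m G \<in> \<G>"
    then have "\<alpha> \<noteq> 0"
      using \<alpha> by metis
    \<comment> \<open>Here H is G divided by \<alpha>. Writing G as \<alpha> times H gives both
      operands the factor \<alpha>, so joint homogeneity extracts it.\<close>
    then have "\<alpha> \<cdot>\<^sub>m ((1 / \<alpha>) \<cdot>\<^sub>m G) = G"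
      by auto
    moreover have H: "(1 / \<alpha>) \<cdot>\<^sub>m G \<in> \<G>"
      using inv G \<alpha> by blast
    ultimately show ?thesis
      using hom A assms(3) by (metis subsetD)
  qed
  show "DG_stable D \<G> bop (\<alpha> \<cdot>\<^sub>m A)"
    unfolding DG_stable_def DG_left_stable_def DG_right_stable_def
  proof (intro conjI ballI)
    fix G assume "G \<in> \<G>"
    then obtain H where H: "H \<in> \<G>"
      "bop G (\<alpha> \<cdot>\<^sub>m A) = \<alpha> \<cdot>\<^sub>m bop H A" "bop (\<alpha> \<cdot>\<^sub>m A) G = \<alpha> \<cdot>\<^sub>m bop A H"
      using factor by blast
    have "cspectrum (bop H A) \<subseteq> D" "cspectrum (bop A H) \<subseteq> D"
      using st H(1) by (auto simp: DG_stable_def DG_left_stable_def DG_right_stable_def)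
    then show "cspectrum (bop G (\<alpha> \<cdot>\<^sub>m A)) \<subseteq> D" "cspectrum (bop (\<alpha> \<cdot>\<^sub>m A) G) \<subseteq> D"
      using H A assms(3) bop scale by (metis subsetD)+
  qed
qed

end
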